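(* Let $\Gamma$ be a simple gain graph on vertex set $[\ell]$ whose gain group $G_\Gamma$ is either $\mathbb{Z}$ or $\mathbb{F}_p$ ($p$ prime). Then $\mathbf{c}\mathcal{A}(\Gamma)$ is divisionally free along edges if and only if $\mathcal{B}(\Gamma)$ is divisionally free along edges.
   Context: A simple gain graph $\Gamma=(V_\Gamma,E_\Gamma,G_\Gamma)$ consists of a finite vertex set $V_\Gamma$, a group $G_\Gamma$ (written additively), and a finite set $E_\Gamma$ of edges, each edge being an equivalence class $[i,j,g]$ of triples $(i,j,g)$ with $i\neq j$ under the equivalence generated by $(i,j,g)\sim(j,i,-g)$. For $V_\Gamma=[\ell]$ and $G_\Gamma\in\{\mathbb{Z},\mathbb{F}_p\}$: $\mathcal{A}(\Gamma)=\{\{x_i-x_j=g\}:[i,j,g]\in E_\Gamma\}$ in $\mathbb{Q}^\ell$ (if $G_\Gamma=\mathbb{Z}$) or $\mathbb{F}_p^\ell$ (if $G_\Gamma=\mathbb{F}_p$); its cone $\mathbf{c}\mathcal{A}(\Gamma)$ is the arrangement in $\mathbb{K}^{\ell+1}$ (coordinates $x_1,\dots,x_\ell,z$) consisting of $\{z=0\}$ and $\{x_i-x_j=gz\}$ for $[i,j,g]\in E_\Gamma$. Fix $q\in\mathbb{C}^\times$ not a root of unity if $G_\Gamma=\mathbb{Z}$, or a primitive $p$-th root of unity if $G_\Gamma=\mathbb{F}_p$; $\mathcal{B}(\Gamma)=\{\{x_i=0\}:1\le i\le\ell\}\cup\{\{x_i-q^gx_j=0\}:[i,j,g]\in E_\Gamma\}$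 in $\mathbb{C}^\ell$. The characteristic polynomial of an arrangement $\mathcal{A}$ in $\mathbb{K}^n$ is $\chi(\mathcal{A},t)=\sum_{X\in L(\mathcal{A})}\mu(X)t^{\dim X}$, where $L(\mathcal{A})$ is the poset of nonempty intersections of subsets of $\mathcal{A}$ ordered by reverse inclusion and $\mu$ is its Möbius function from $\mathbb{K}^n$. Contraction: for an edge $e$ with chosen direction $(i,j,g)$, $\Gamma/e$ has vertex set $V_\Gamma\setminus\{i\}$ and edges all $[u,v,h]\in E_\Gamma$ with $u,v\ne i$ together with $[k,j,h+g]$ for each $[k,i,h]\in E_\Gamma$, $k\neq i$ (the resulting arrangements are independent of the direction up to affine equivalence). $\mathbf{c}\mathcal{A}(\Gamma)$ is divisionally free along edges if either $E_\Gamma=\varnothing$, or there exists $e\in E_\Gamma$ such that $\mathbf{c}\mathcal{A}(\Gamma/e)$ is divisionally free along edges and $\chi(\mathbf{c}\mathcal{A}(\Gamma/e),t)$ divides $\chi(\mathbf{c}\mathcal{A}(\Gamma),t)$. Divisional freeness along edges for $\mathcal{B}(\Gamma)$ is defined identically with $\mathcal{B}$ in place of $\mathbf{c}\mathcal{A}$. *)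

theory Defs
  imports Complex_Main "HOL-Library.Function_Algebras"
    "HOL-Computational_Algebra.Polynomial" "Berlekamp_Zassenhaus.Finite_Field"
begin

subsection \<open>Gain graphs\<close>

text \<open>The set \<open>edge i j g\<close> is literally the equivalence class of \<open>(i, j, g)\<close> under the
  relation generated by \<open>(i, j, g) ~ (j, i, - g)\<close>; in particular parallel edges with different
  gains are allowed, and \<open>edge i j g = edge j i (- g)\<close>.\<close>

definition edge :: "'v \<Rightarrow> 'v \<Rightarrow> 'g::group_add \<Rightarrow> ('v \<times> 'v \<times> 'g) set" where
  "edge i j g = {(i, j, g), (j, i, - g)}"

record ('v, 'g) gain_graph =
  vertices :: "'v set"
  edges :: "('v \<times> 'v \<times> 'g) set set"

definition simple_gain_graph :: "('v, 'g::group_add) gain_graph \<Rightarrow> bool" where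
  "simple_gain_graph \<Gamma> \<longleftrightarrow> finite (vertices \<Gamma>) \<and> finite (edges \<Gamma>) \<and>
     (\<forall>e\<in>edges \<Gamma>. \<exists>i\<in>vertices \<Gamma>. \<exists>j\<in>vertices \<Gamma>. \<exists>g. i \<noteq> j \<and> e = edge i j g)"

text \<open>Contraction of \<open>edge i j g\<close> in the direction \<open>(i, j, g)\<close>. An edge from \<open>j\<close> to \<open>i\<close> that is
  parallel to the contracted one (or equal to it) would become a loop at \<open>j\<close>; loops are not
  edges of a simple gain graph, hence the condition \<open>k \<noteq> j\<close>.\<close>

definition contract ::
  "('v, 'g::group_add) gain_graph \<Rightarrow> 'v \<Rightarrow> 'v \<Rightarrow> 'g \<Rightarrow> ('v, 'g) gain_graph" where
  "contract \<Gamma> i j g =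
     \<lparr> vertices = vertices \<Gamma> - {i},
       edges = {edge u v h | u v h. edge u v h \<in> edges \<Gamma> \<and> u \<noteq> i \<and> v \<noteq> i} \<union>
               {edge k j (h + g) | k h. edge k i h \<in> edges \<Gamma> \<and> k \<noteq> i \<and> k \<noteq> j} \<rparr>"


subsection \<open>Arrangements and their characteristic polynomials\<close>

text \<open>\<open>coord_space I\<close> is \<open>K\<^sup>I\<close>: vectors are functions vanishing outside the index set \<open>I\<close>.\<close>

definition coord_space :: "'i set \<Rightarrow> ('i \<Rightarrow> 'k::zero) set" where
  "coord_space I = {x. \<forall>i. i \<notin> I \<longrightarrow> x i = 0}"

interpretation coord: vector_space "\<lambda>(c::'k::field) (x::'i \<Rightarrow> 'k) i. c * x i"
  by unfold_locales (auto simp: fun_eq_iff algebra_simps)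

text \<open>Dimension of a nonempty affine subspace, i.e. of its space of directions.\<close>

definition flat_dim :: "('i \<Rightarrow> 'k::field) set \<Rightarrow> nat" where
  "flat_dim X = coord.dim {x - y | x y. x \<in> X \<and> y \<in> X}"

text \<open>The empty subset of the arrangement contributes the ambient space \<open>V\<close>.\<close>

definition intersection_poset :: "'a set \<Rightarrow> 'a set set \<Rightarrow> 'a set set" where
  "intersection_poset V \<A> = {V \<inter> \<Inter>\<S> | \<S>. \<S> \<subseteq> \<A> \<and> V \<inter> \<Inter>\<S> \<noteq> {}}"

text \<open>Moebius function of a finite family of sets ordered by reverse inclusion.\<close>

function moebius :: "'a set set \<Rightarrow> 'a set \<Rightarrow> 'a set \<Rightarrow> int" where
  "moebius L X Y =
     (if finite L \<and> X \<in> L \<and> Y \<in> L \<and> Y \<subseteq> X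
      then if X = Y then 1 else - (\<Sum>Z\<in>{Z\<in>L. Y \<subset> Z \<and> Z \<subseteq> X}. moebius L X Z)
      else 0)"
  by pat_completeness auto
termination
proof (relation "measure (\<lambda>(L, X, Y). card {Z\<in>L. Y \<subset> Z})", goal_cases)
  case (2 L X Y Z)
  then have "{W\<in>L. Z \<subset> W} \<subset> {W\<in>L. Y \<subset> W}" by auto
  with 2 show ?case by (auto intro!: psubset_card_mono)
qed auto

declare moebius.simps [simp del]

definition arrangement_char_poly ::
  "('i \<Rightarrow> 'k::field) set \<Rightarrow> ('i \<Rightarrow> 'k) set set \<Rightarrow> int poly" where
  "arrangement_char_poly V \<A> =
     (\<Sum>X\<in>intersection_poset V \<A>. monom (moebius (intersection_poset V \<A>) V X) (flat_dim X))"


subsection \<open>The arrangements of a gain graph\<close>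

text \<open>The coordinate \<open>x\<^sub>i\<close> has index \<open>Some i\<close> and the coordinate \<open>z\<close> has index \<open>None\<close>. The map
  \<open>\<iota>\<close> sends gains to scalars of the ground field.\<close>

definition cone_space :: "('v, 'g) gain_graph \<Rightarrow> ('v option \<Rightarrow> 'k::field) set" where
  "cone_space \<Gamma> = coord_space (insert None (Some ` vertices \<Gamma>))"

definition cone_arrangement ::
  "('g::group_add \<Rightarrow> 'k::field) \<Rightarrow> ('v, 'g) gain_graph \<Rightarrow> ('v option \<Rightarrow> 'k) set set" where
  "cone_arrangement \<iota> \<Gamma> =
     insert {x \<in> cone_space \<Gamma>. x None = 0}
       {{x \<in> cone_space \<Gamma>. x (Some i) - x (Some j) = \<iota> g * x None} | i j g.
          edge i j g \<in> edges \<Gamma>}"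

text \<open>The map \<open>\<phi>\<close> is the exponential \<open>g \<mapsto> q\<^sup>g\<close>.\<close>

definition b_arrangement ::
  "('g::group_add \<Rightarrow> complex) \<Rightarrow> ('v, 'g) gain_graph \<Rightarrow> ('v \<Rightarrow> complex) set set" where
  "b_arrangement \<phi> \<Gamma> =
     {{x \<in> coord_space (vertices \<Gamma>). x i = 0} | i. i \<in> vertices \<Gamma>} \<union>
     {{x \<in> coord_space (vertices \<Gamma>). x i - \<phi> g * x j = 0} | i j g. edge i j g \<in> edges \<Gamma>}"


subsection \<open>Divisional freeness along edges\<close>

text \<open>The parameter \<open>\<chi>\<close> assigns to a gain graph the characteristic polynomial of the arrangement
  under consideration.\<close>

inductive div_free_along_edges ::
  "(('v, 'g::group_add) gain_graph \<Rightarrow> int poly) \<Rightarrow> ('v, 'g) gain_graph \<Rightarrow> bool"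
  for \<chi> where
  empty: "edges \<Gamma> = {} \<Longrightarrow> div_free_along_edges \<chi> \<Gamma>"
| contract: "edge i j g \<in> edges \<Gamma> \<Longrightarrow> div_free_along_edges \<chi> (contract \<Gamma> i j g) \<Longrightarrow>
    \<chi> (contract \<Gamma> i j g) dvd \<chi> \<Gamma> \<Longrightarrow> div_free_along_edges \<chi> \<Gamma>"

definition cone_div_free ::
  "('g::group_add \<Rightarrow> 'k::field) \<Rightarrow> ('v, 'g) gain_graph \<Rightarrow> bool" where
  "cone_div_free \<iota> =
     div_free_along_edges (\<lambda>\<Gamma>. arrangement_char_poly (cone_space \<Gamma>) (cone_arrangement \<iota> \<Gamma>))"

definition b_div_free :: "('g::group_add \<Rightarrow> complex) \<Rightarrow> ('v, 'g) gain_graph \<Rightarrow> bool" where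
  "b_div_free \<phi> =
     div_free_along_edges
       (\<lambda>\<Gamma>. arrangement_char_poly (coord_space (vertices \<Gamma>)) (b_arrangement \<phi> \<Gamma>))"

definition primitive_root_of_unity :: "nat \<Rightarrow> complex \<Rightarrow> bool" where
  "primitive_root_of_unity n q \<longleftrightarrow> n > 0 \<and> q ^ n = 1 \<and> (\<forall>k. 0 < k \<and> k < n \<longrightarrow> q ^ k \<noteq> 1)"

end

theory Submission
  imports Defs
begin

text \<open>By Whitney's theorem, a characteristic polynomial is an alternating sum over subfamilies of
  hyperplanes. Let \<open>P\<close> be the sum of \<open>(- 1)\<^bsup>|S|\<^esup> t\<^bsup>c(S)\<^esup>\<close> over the balanced edge sets
  \<open>S\<close>, where \<open>c(S)\<close> counts connected components. In both arrangements the unbalanced edge sets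
  cancel: for the cone they force \<open>z = 0\<close>, so adding \<open>{z = 0}\<close> does not change the intersection,
  and for \<open>\<B>(\<Gamma>)\<close> they force some \<open>x\<^sub>i = 0\<close>. The balanced ones give \<open>(t - 1) P(t)\<close>
  and \<open>P(t - 1)\<close> respectively. Hence the two divisibility conditions on a contraction agree,
  namely with divisibility of \<open>P\<close>.\<close>

subsection \<open>Whitney's theorem\<close>

text \<open>Adding or removing \<open>v\<close> pairs off the subsets of \<open>A\<close>, and the
  two members of each pair cancel. The same pairing later removes the unbalanced edge sets of
  \<B>(\<Gamma>).\<close>

lemma sum_Pow_sign_reversing:
  fixes f :: "'a set \<Rightarrow> 'b::ab_group_add"
  assumes "finite A" and "v \<in> A" and "\<And>S. S \<subseteq> A - {v} \<Longrightarrow> f (insert v S) = - f S"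
  shows "(\<Sum>S\<in>Pow A. f S) = 0"
proof -
  let ?B = "A - {v}"
  have "A = insert v ?B"
    using assms(2) by auto
  then have "(\<Sum>S\<in>Pow A. f S) = (\<Sum>S\<in>Pow ?B \<union> insert v ` Pow ?B. f S)"
    by (metis Pow_insert)
  also have "\<dots> = (\<Sum>S\<in>Pow ?B. f S) + (\<Sum>S\<in>insert v ` Pow ?B. f S)"
    using assms(1) by (intro sum.union_disjoint) auto
  also have "(\<Sum>S\<in>insert v ` Pow ?B. f S) = (\<Sum>S\<in>Pow ?B. f (insert v S))"
    by (intro sum.reindex_cong[OF _ refl refl]) (auto simp: inj_on_def)
  also have "\<dots> = (\<Sum>S\<in>Pow ?B. - f S)"
    using assms(3) by (intro sum.cong) auto
  finally show ?thesis
    by (simp add: sum_negf)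
qed

lemma sum_Pow_alternating:
  assumes "finite A"
  shows "(\<Sum>S\<in>Pow A. (- 1) ^ card S) = (if A = {} then 1 else (0::'b::comm_ring_1))"
proof (cases "A = {}")
  case False
  then obtain v where "v \<in> A" by auto
  have "(- 1) ^ card (insert v S) = - ((- 1) ^ card S :: 'b)" if "S \<subseteq> A - {v}" for S
    using that assms finite_subset[of S A] by (subst card_insert_disjoint) auto
  then show ?thesis
    using False sum_Pow_sign_reversing[OF assms \<open>v \<in> A\<close>, of "\<lambda>S. (- 1) ^ card S :: 'b"] by auto
qed auto

text \<open>Hyperplanes are later indexed by a disjoint sum: \<open>Inl\<close> for
  \<open>z = 0\<close> or the coordinate hyperplanes, \<open>Inr\<close> for the edges. Fixing the
  edge part \<open>T\<close> and summing over \<open>J\<close> first exposes the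
  cancellation.\<close>

lemma sum_Pow_Plus:
  assumes "finite A" and "finite B"
  shows "(\<Sum>S\<in>Pow (A <+> B). f S) = (\<Sum>T\<in>Pow B. \<Sum>J\<in>Pow A. f (J <+> T))"
proof -
  have "bij_betw (\<lambda>(T, J). J <+> T) (Pow B \<times> Pow A) (Pow (A <+> B))"
    by (rule bij_betw_byWitness[where f' = "\<lambda>S. (Inr -` S, Inl -` S)"]) (auto simp: Plus_def)
  from sum.reindex_bij_betw[OF this, of f] show ?thesis
    using assms by (simp add: sum.cartesian_product case_prod_unfold)
qed

text \<open>The right-hand side obeys the recursion that defines the Moebius function. Summed over
  all flats containing \<open>X\<close>, it becomes the alternating sum over all sets of hyperplanes
  containing \<open>X\<close>, which vanishes for \<open>X \<noteq> V\<close>. For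
  \<open>X = V\<close>, properness of the hyperplanes leaves only the empty subfamily.\<close>

lemma moebius_eq_sum_subfamilies:
  fixes H :: "'e \<Rightarrow> 'a set"
  assumes "finite I" and "\<And>e. e \<in> I \<Longrightarrow> \<not> V \<subseteq> H e"
    and "X \<in> intersection_poset V (H ` I)"
  shows "moebius (intersection_poset V (H ` I)) V X
    = (\<Sum>S\<in>{S \<in> Pow I. V \<inter> \<Inter> (H ` S) = X}. (- 1) ^ card S)"
proof -
  define F where "F S = V \<inter> \<Inter> (H ` S)" for S
  define L where "L = intersection_poset V (H ` I)"
  have L: "L = {F S | S. S \<subseteq> I \<and> F S \<noteq> {}}"
    unfolding L_def intersection_poset_def F_def by (auto simp: subset_image_iff)
  have "L \<subseteq> F ` Pow I"
    unfolding L by auto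
  then have finL: "finite L"
    by (meson assms(1) finite_Pow_iff finite_imageI finite_subset)
  have "X \<in> L" using assms(3) by (simp add: L_def)
  then have "moebius L V X = (\<Sum>S\<in>{S \<in> Pow I. F S = X}. (- 1) ^ card S)"
  proof (induction X rule: measure_induct_rule[where f = "\<lambda>X. card {Z \<in> L. X \<subset> Z}"])
    case (less X)
    obtain S0 where S0: "S0 \<subseteq> I" "X = F S0" "X \<noteq> {}"
      using less.prems by (auto simp: L)
    have "X \<subseteq> V" by (auto simp: S0 F_def)
    have "F {} = V" by (simp add: F_def)
    then have VL: "V \<in> L"
      using S0 \<open>X \<subseteq> V\<close> unfolding L by blast
    show ?case
    proof (cases "X = V")
      case True
      have "S = {}" if "S \<subseteq> I" "F S = V" for S
      proof (rule ccontr)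
        assume "S \<noteq> {}"
        then obtain e where "e \<in> S" by auto
        then have "F S \<subseteq> H e" by (auto simp: F_def)
        then show False
          using assms(2)[of e] \<open>e \<in> S\<close> that by auto
      qed
      then have "{S \<in> Pow I. F S = X} = {{}}"
        using True by (auto simp: F_def)
      then show ?thesis
        using VL finL True by (subst moebius.simps) auto
    next
      case False
      let ?A = "{e \<in> I. X \<subseteq> H e}"
      let ?g = "\<lambda>Z. \<Sum>S\<in>{S \<in> Pow I. F S = Z}. (- 1) ^ card S :: int"
      have "S0 \<noteq> {}" using False S0 by (auto simp: F_def)
      then have "?A \<noteq> {}" using S0 by (auto simp: F_def)
      then have "0 = (\<Sum>S\<in>Pow ?A. (- 1) ^ card S :: int)"
        using assms(1) by (subst sum_Pow_alternating) auto
      also have "Pow ?A = {S \<in> Pow I. X \<subseteq> F S}"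
        using \<open>X \<subseteq> V\<close> by (auto simp: F_def)
      \<comment> \<open>The subfamilies are sorted by their intersection, which contains the
        nonempty set \<open>X\<close> and so is a flat.\<close>
      also have "\<dots> = (\<Union>Z\<in>{Z \<in> L. X \<subseteq> Z}. {S \<in> Pow I. F S = Z})"
        using S0(3) unfolding L by blast
      also have "(\<Sum>S\<in>\<dots>. (- 1) ^ card S :: int) = (\<Sum>Z\<in>{Z \<in> L. X \<subseteq> Z}. ?g Z)"
        using finL assms(1) by (intro sum.UNION_disjoint) auto
      also have "{Z \<in> L. X \<subseteq> Z} = insert X {Z \<in> L. X \<subset> Z}"
        using less.prems by auto
      also have "sum ?g \<dots> = ?g X + sum ?g {Z \<in> L. X \<subset> Z}"
        using finL by (subst sum.insert) auto
      also have "sum ?g {Z \<in> L. X \<subset> Z} = (\<Sum>Z\<in>{Z \<in> L. X \<subset> Z}. moebius L V Z)"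
      proof (intro sum.cong refl)
        fix Z assume "Z \<in> {Z \<in> L. X \<subset> Z}"
        moreover from this have "card {W \<in> L. Z \<subset> W} < card {W \<in> L. X \<subset> W}"
          using finL by (intro psubset_card_mono) auto
        ultimately show "?g Z = moebius L V Z"
          using less.IH by auto
      qed
      also have "{Z \<in> L. X \<subset> Z} = {Z \<in> L. X \<subset> Z \<and> Z \<subseteq> V}"
        by (auto simp: L F_def)
      also have "(\<Sum>Z\<in>\<dots>. moebius L V Z) = - moebius L V X"
        using finL VL less.prems \<open>X \<subseteq> V\<close> False by (subst (2) moebius.simps) auto
      finally show ?thesis by simp
    qed
  qed
  then show ?thesis by (simp add: L_def F_def)
qed

text \<open>The family may have repetitions: the contributions of repeated members cancel.\<close>

lemma arrangement_char_poly_eq_sum_subfamilies: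
  fixes H :: "'e \<Rightarrow> ('i \<Rightarrow> 'k::field) set"
  assumes "finite I" and "\<And>e. e \<in> I \<Longrightarrow> \<not> V \<subseteq> H e"
    and "a \<in> V" and "\<And>e. e \<in> I \<Longrightarrow> a \<in> H e"
  shows "arrangement_char_poly V (H ` I)
    = (\<Sum>S\<in>Pow I. (- 1) ^ card S * [:0, 1:] ^ flat_dim (V \<inter> \<Inter> (H ` S)))"
proof -
  define F where "F S = V \<inter> \<Inter> (H ` S)" for S
  define L where "L = intersection_poset V (H ` I)"
  have L: "L = F ` Pow I"
  proof -
    \<comment> \<open>The point \<open>a\<close> lies in every intersection, so all subfamilies
      contribute.\<close>
    have "F S \<noteq> {}" if "S \<subseteq> I" for S
      using that assms(3,4) by (force simp: F_def)
    moreover have "L = {F S | S. S \<subseteq> I \<and> F S \<noteq> {}}"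
      unfolding L_def intersection_poset_def F_def by (auto simp: subset_image_iff)
    ultimately show ?thesis by blast
  qed
  have monom: "monom ((- 1) ^ n) m = ((- 1) ^ n * [:0, 1:] ^ m :: int poly)" for n m
    by (cases "even n") (simp_all add: monom_altdef)
  have "arrangement_char_poly V (H ` I)
    = (\<Sum>X\<in>L. \<Sum>S\<in>{S \<in> Pow I. F S = X}. monom ((- 1) ^ card S) (flat_dim (F S)))"
    unfolding arrangement_char_poly_def L_def[symmetric]
  proof (intro sum.cong refl)
    fix X assume "X \<in> L"
    then have "moebius L V X = (\<Sum>S\<in>{S \<in> Pow I. F S = X}. (- 1) ^ card S)"
      unfolding L_def F_def using assms by (intro moebius_eq_sum_subfamilies) auto
    then show "monom (moebius L V X) (flat_dim X)
      = (\<Sum>S\<in>{S \<in> Pow I. F S = X}. monom ((- 1) ^ card S) (flat_dim (F S)))"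
      by (simp add: monom_sum)
  qed
  also have "\<dots> = (\<Sum>S\<in>Pow I. monom ((- 1) ^ card S) (flat_dim (F S)))"
    unfolding L using assms(1) by (intro sum.image_gen[symmetric]) simp
  finally show ?thesis
    by (simp add: monom F_def)
qed


subsection \<open>Dimensions\<close>

lemma flat_dim_subspace:
  assumes "coord.subspace X"
  shows "flat_dim X = coord.dim X"
proof -
  have "{x - y | x y. x \<in> X \<and> y \<in> X} = X"
  proof -
    have "x \<in> {x - y | x y. x \<in> X \<and> y \<in> X}" if "x \<in> X" for x
      using that coord.subspace_0[OF assms] by (intro CollectI exI[of _ x] exI[of _ 0]) (auto simp: zero_fun_def)
    then show ?thesis
      using coord.subspace_diff[OF assms] by blast
  qed
  then show ?thesis by (simp add: flat_dim_def)
qed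

lemma sum_fun_apply: "(\<Sum>r\<in>P. f r) s = (\<Sum>r\<in>P. f r s)"
  by (induction P rule: infinite_finite_induct) auto

text \<open>Evaluation at the points of \<open>P\<close> is a linear isomorphism from
  \<open>W\<close> onto the functions on \<open>P\<close>: \<open>det\<close> makes it injective,
  the dual family \<open>b\<close> surjective. Later \<open>P\<close> consists of component
  representatives, together with the coordinate \<open>z\<close> where it is free, so dimensions
  become component counts.\<close>

lemma dim_eq_card_dual_points:
  fixes W :: "('i \<Rightarrow> 'k::field) set" and b :: "'i \<Rightarrow> 'i \<Rightarrow> 'k"
  assumes W: "coord.subspace W" and fin: "finite P"
    and bW: "\<And>r. r \<in> P \<Longrightarrow> b r \<in> W"
    and dual: "\<And>r s. r \<in> P \<Longrightarrow> s \<in> P \<Longrightarrow> b r s = (if r = s then 1 else 0)"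
    and det: "\<And>x. x \<in> W \<Longrightarrow> (\<And>r. r \<in> P \<Longrightarrow> x r = 0) \<Longrightarrow> x = 0"
  shows "coord.dim W = card P"
proof -
  have inj: "inj_on b P"
    by (rule inj_onI) (metis dual zero_neq_one)
  have sum_app: "(\<Sum>r\<in>P. (\<lambda>i. c r * b r i)) s = c s" if "s \<in> P" for c s
  proof -
    have "(\<Sum>r\<in>P. (\<lambda>i. c r * b r i)) s = (\<Sum>r\<in>P. c r * b r s)"
      by (simp add: sum_fun_apply)
    also have "\<dots> = (\<Sum>r\<in>P. if r = s then c s else 0)"
      using that by (intro sum.cong) (auto simp: dual)
    finally show ?thesis using that fin by simp
  qed
  show ?thesis
  proof (rule coord.dim_unique[where B = "b ` P"])
    show "b ` P \<subseteq> W" using bW by auto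
    show "W \<subseteq> coord.span (b ` P)"
    proof
      fix x assume x: "x \<in> W"
      \<comment> \<open>\<open>?y\<close> interpolates \<open>x\<close> on \<open>P\<close>, so the
        difference vanishes on \<open>P\<close> and \<open>det\<close> applies to it.\<close>
      let ?y = "\<Sum>r\<in>P. (\<lambda>i. x r * b r i)"
      have "?y \<in> W"
        by (intro coord.subspace_sum[OF W] coord.subspace_scale[OF W] bW)
      then have "x - ?y = 0"
        using x by (intro det coord.subspace_diff[OF W]) (auto simp: sum_app)
      moreover have "?y \<in> coord.span (b ` P)"
        by (intro coord.span_sum coord.span_scale coord.span_base) auto
      ultimately show "x \<in> coord.span (b ` P)" by simp
    qed
    show "coord.independent (b ` P)"
    proof (rule coord.independent_if_scalars_zero)
      fix f x assume *: "(\<Sum>x\<in>b ` P. (\<lambda>i. f x * x i)) = 0" "x \<in> b ` P"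
      then obtain s where s: "s \<in> P" "x = b s" by auto
      have "(\<Sum>r\<in>P. (\<lambda>i. f (b r) * b r i)) = 0"
        using * by (simp add: sum.reindex[OF inj])
      then show "f x = 0"
        using sum_app[OF s(1), of "\<lambda>r. f (b r)"] s by simp
    qed (use fin in auto)
    show "card (b ` P) = card P" by (rule card_image[OF inj])
  qed
qed


subsection \<open>Connected components and balance\<close>

definition adj :: "('v \<times> 'v \<times> 'g) set set \<Rightarrow> ('v \<times> 'v) set" where
  "adj S = {(i, j). \<exists>g. (i, j, g) \<in> \<Union>S}"

text \<open>A canonical representative of the component of \<open>i\<close>: the choice sees only
  the set of reachable vertices, which mutually reachable vertices share. The size of the image of
  \<open>vertices \<Gamma>\<close> under \<open>root S\<close> is therefore the number of
  components, isolated vertices included.\<close>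

definition root :: "('v \<times> 'v \<times> 'g) set set \<Rightarrow> 'v \<Rightarrow> 'v" where
  "root S i = (SOME j. (i, j) \<in> (adj S)\<^sup>*)"

text \<open>\<open>\<theta>\<close> is a potential. For a set of edges its existence is equivalent
  to the usual condition that every closed walk has gain zero.\<close>

definition balanced :: "('v \<times> 'v \<times> 'g::ab_group_add) set set \<Rightarrow> bool" where
  "balanced S \<longleftrightarrow> (\<exists>\<theta>. \<forall>(i, j, g)\<in>\<Union>S. g = \<theta> i - \<theta> j)"

lemma balancedI:
  assumes "\<And>i j g. (i, j, g) \<in> \<Union>S \<Longrightarrow> g = \<theta> i - \<theta> j"
  shows "balanced S"
  unfolding balanced_def using assms by (intro exI[of _ \<theta>]) fast

text \<open>This is the polynomial \<open>P\<close> of the proof idea, known as Zaslavsky's balanced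
  chromatic polynomial.\<close>

definition balanced_poly :: "('v, 'g::ab_group_add) gain_graph \<Rightarrow> int poly" where
  "balanced_poly \<Gamma> = (\<Sum>S\<in>{S \<in> Pow (edges \<Gamma>). balanced S}.
     (- 1) ^ card S * [:0, 1:] ^ card (root S ` vertices \<Gamma>))"

lemma simple_edge_vertices:
  assumes "simple_gain_graph \<Gamma>" and "(i, j, g) \<in> \<Union>(edges \<Gamma>)"
  shows "i \<in> vertices \<Gamma>" "j \<in> vertices \<Gamma>" "i \<noteq> j"
proof -
  obtain e where e: "e \<in> edges \<Gamma>" "(i, j, g) \<in> e" using assms(2) by auto
  obtain u v h where u: "u \<in> vertices \<Gamma>" "v \<in> vertices \<Gamma>" "u \<noteq> v" "e = edge u v h"
    using assms(1) e(1) unfolding simple_gain_graph_def by blast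
  then show "i \<in> vertices \<Gamma>" "j \<in> vertices \<Gamma>" "i \<noteq> j"
    using e(2) by (auto simp: edge_def)
qed

lemma sym_adj:
  assumes "simple_gain_graph \<Gamma>" and "S \<subseteq> edges \<Gamma>"
  shows "sym (adj S)"
proof (rule symI)
  fix i j assume "(i, j) \<in> adj S"
  then obtain g e where e: "e \<in> S" "(i, j, g) \<in> e" by (auto simp: adj_def)
  then obtain u v h where "e = edge u v h"
    using assms unfolding simple_gain_graph_def by blast
  then have "(j, i, - g) \<in> e"
    using e(2) by (auto simp: edge_def)
  then show "(j, i) \<in> adj S"
    using e(1) by (auto simp: adj_def)
qed

lemma root_reachable: "(i, root S i) \<in> (adj S)\<^sup>*"
  unfolding root_def by (rule someI[where x = i]) simp

lemma root_eq:
  assumes "simple_gain_graph \<Gamma>" and "S \<subseteq> edges \<Gamma>" and "(i, j) \<in> (adj S)\<^sup>*"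
  shows "root S i = root S j"
proof -
  have "(j, i) \<in> (adj S)\<^sup>*"
    using sym_rtrancl[OF sym_adj[OF assms(1,2)]] assms(3) by (auto dest: symD)
  then have "(i, k) \<in> (adj S)\<^sup>* \<longleftrightarrow> (j, k) \<in> (adj S)\<^sup>*" for k
    using assms(3) by (meson rtrancl_trans)
  then show ?thesis by (simp add: root_def)
qed

lemma root_eq_edge:
  assumes "simple_gain_graph \<Gamma>" and "S \<subseteq> edges \<Gamma>" and "(i, j, g) \<in> \<Union>S"
  shows "root S i = root S j"
  using assms by (intro root_eq[OF assms(1,2)]) (auto simp: adj_def)

lemma root_root:
  assumes "simple_gain_graph \<Gamma>" and "S \<subseteq> edges \<Gamma>"
  shows "root S (root S i) = root S i"
  using root_eq[OF assms root_reachable] by simp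

text \<open>The root is joined to \<open>i\<close> by a path in \<open>S\<close>. The typical
  \<open>Q\<close> is membership in the vertex set, a coordinate of a solution, or the vanishing of
  that coordinate.\<close>

lemma root_invariant:
  assumes "\<And>i j g. (i, j, g) \<in> \<Union>S \<Longrightarrow> Q i = Q j"
  shows "Q (root S i) = Q i"
proof -
  have "Q i = Q j" if "(i, j) \<in> (adj S)\<^sup>*" for j
    using that
  proof (induction rule: rtrancl_induct)
    case (step j k)
    then obtain g where "(j, k, g) \<in> \<Union>S" by (auto simp: adj_def)
    then show ?case using step.IH assms by metis
  qed simp
  then show ?thesis using root_reachable by metis
qed

lemma root_in_vertices:
  assumes "simple_gain_graph \<Gamma>" and "S \<subseteq> edges \<Gamma>"
  shows "root S i \<in> vertices \<Gamma> \<longleftrightarrow> i \<in> vertices \<Gamma>"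
proof (rule root_invariant[where Q = "\<lambda>i. i \<in> vertices \<Gamma>"])
  fix i j g assume "(i, j, g) \<in> \<Union>S"
  then have "(i, j, g) \<in> \<Union>(edges \<Gamma>)" using assms(2) by auto
  then show "(i \<in> vertices \<Gamma>) = (j \<in> vertices \<Gamma>)"
    using simple_edge_vertices[OF assms(1)] by blast
qed

section \<open>The characteristic polynomial of the cone\<close>

lemma mem_cone_space: "x \<in> cone_space \<Gamma> \<longleftrightarrow> (\<forall>i. i \<notin> vertices \<Gamma> \<longrightarrow> x (Some i) = 0)"
  by (fastforce simp: cone_space_def coord_space_def elim: option.exhaust)

text \<open>With \<open>z = 0\<close> the gains drop out and the solutions are the functions
  constant on components. The component indicators form the dual family.\<close>

lemma cone_restriction_dim:
  fixes \<Gamma> :: "('v, 'g::ab_group_add) gain_graph"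
  assumes "simple_gain_graph \<Gamma>" and "S \<subseteq> edges \<Gamma>"
  shows "flat_dim {x \<in> cone_space \<Gamma>. x None = (0::'k::field) \<and>
      (\<forall>(i, j, g)\<in>\<Union>S. x (Some i) = x (Some j))}
    = card (root S ` vertices \<Gamma>)" (is "flat_dim ?W = _")
proof -
  let ?b = "\<lambda>r k. case (r, k) of (Some r, Some i) \<Rightarrow>
      if i \<in> vertices \<Gamma> \<and> root S i = r then 1 else 0 | _ \<Rightarrow> (0::'k)"
  have sub: "coord.subspace ?W"
    by (rule coord.subspaceI) (fastforce simp: mem_cone_space)+
  have "coord.dim ?W = card (Some ` root S ` vertices \<Gamma>)"
  proof (rule dim_eq_card_dual_points[OF sub, where b = ?b])
    show "finite (Some ` root S ` vertices \<Gamma>)"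
      using assms(1) by (simp add: simple_gain_graph_def)
  next
    fix r assume "r \<in> Some ` root S ` vertices \<Gamma>"
    moreover have "(i \<in> vertices \<Gamma> \<and> root S i = s) = (j \<in> vertices \<Gamma> \<and> root S j = s)"
      if "(i, j, g) \<in> \<Union>S" for i j g s
      using root_eq_edge[OF assms that] root_in_vertices[OF assms] by metis
    ultimately show "?b r \<in> ?W"
      by (fastforce simp: mem_cone_space split: option.splits)
  next
    fix r s assume "r \<in> Some ` root S ` vertices \<Gamma>" "s \<in> Some ` root S ` vertices \<Gamma>"
    then show "?b r s = (if r = s then 1 else 0)"
      by (auto simp: root_root[OF assms] root_in_vertices[OF assms] split: if_splits)
  next
    fix x assume x: "x \<in> ?W" "\<And>r. r \<in> Some ` root S ` vertices \<Gamma> \<Longrightarrow> x r = 0"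
    have "x (Some i) = 0" for i
    proof (cases "i \<in> vertices \<Gamma>")
      case True
      have "x (Some (root S i)) = x (Some i)"
        using x(1) by (intro root_invariant[where Q = "\<lambda>i. x (Some i)"]) auto
      then show ?thesis using x(2) True by auto
    qed (use x in \<open>auto simp: mem_cone_space\<close>)
    then have "x k = 0" for k using x by (cases k) auto
    then show "x = 0" by auto
  qed
  then show ?thesis
    by (simp only: flat_dim_subspace[OF sub]) (simp add: card_image)
qed

text \<open>Besides the component indicators, a potential yields one solution with
  \<open>z = 1\<close>, which accounts for the \<open>Suc\<close>.\<close>

lemma cone_balanced_dim:
  fixes \<Gamma> :: "('v, 'g::ab_group_add) gain_graph" and \<iota> :: "'g \<Rightarrow> 'k::field"
  assumes "simple_gain_graph \<Gamma>" and "S \<subseteq> edges \<Gamma>" and "balanced S"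
    and add: "\<And>g h. \<iota> (g + h) = \<iota> g + \<iota> h"
  shows "flat_dim {x \<in> cone_space \<Gamma>.
      (\<forall>(i, j, g)\<in>\<Union>S. x (Some i) - x (Some j) = \<iota> g * x None)}
    = Suc (card (root S ` vertices \<Gamma>))" (is "flat_dim ?W = _")
proof -
  note S = assms(1,2)
  obtain \<theta> where \<theta>: "\<And>i j g. (i, j, g) \<in> \<Union>S \<Longrightarrow> g = \<theta> i - \<theta> j"
    using assms(3) unfolding balanced_def by fast
  have diff: "\<iota> (g - h) = \<iota> g - \<iota> h" for g h
    using add[of "g - h" h] by simp
  \<comment> \<open>\<open>b None\<close> is the image of the potential under
    \<open>\<iota>\<close>, shifted on each component so as to vanish at the root; this makes it
    dual to the points of \<open>?P\<close>.\<close>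
  define b where "b r k = (case k of
        None \<Rightarrow> if r = None then 1 else 0
      | Some i \<Rightarrow> if i \<in> vertices \<Gamma> then
          (case r of None \<Rightarrow> \<iota> (\<theta> i) - \<iota> (\<theta> (root S i))
           | Some r \<Rightarrow> if root S i = r then 1 else 0) else 0)" for r k
  let ?P = "insert None (Some ` root S ` vertices \<Gamma>)"
  have sub: "coord.subspace ?W"
    by (rule coord.subspaceI) (fastforce simp: mem_cone_space algebra_simps)+
  have fin: "finite (vertices \<Gamma>)"
    using assms(1) by (simp add: simple_gain_graph_def)
  have "coord.dim ?W = card ?P"
  proof (rule dim_eq_card_dual_points[OF sub, where b = b])
    fix r assume r: "r \<in> ?P"
    have "b r (Some i) - b r (Some j) = \<iota> g * b r None" if "(i, j, g) \<in> \<Union>S" for i j g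
    proof -
      have "i \<in> vertices \<Gamma>" "j \<in> vertices \<Gamma>"
        using simple_edge_vertices[OF S(1) subsetD[OF Union_mono[OF S(2)] that]] by auto
      then show ?thesis
        using root_eq_edge[OF S that] \<theta>[OF that] by (auto simp: b_def diff split: option.splits)
    qed
    moreover have "b r \<in> cone_space \<Gamma>"
      by (auto simp: mem_cone_space b_def split: option.splits)
    ultimately show "b r \<in> ?W" by blast
  next
    fix r s assume "r \<in> ?P" "s \<in> ?P"
    then show "b r s = (if r = s then 1 else 0)"
      by (auto simp: b_def root_root[OF S] root_in_vertices[OF S] split: if_splits)
  next
    fix x assume x: "x \<in> ?W" "\<And>r. r \<in> ?P \<Longrightarrow> x r = 0"
    \<comment> \<open>Since \<open>None\<close> lies in \<open>?P\<close>, the coordinate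
      \<open>z\<close> vanishes and the gains drop out.\<close>
    have eq: "x (Some i) = x (Some j)" if "(i, j, g) \<in> \<Union>S" for i j g
      using x that by fastforce
    have "x (Some i) = 0" for i
    proof (cases "i \<in> vertices \<Gamma>")
      case True
      have "x (Some (root S i)) = x (Some i)"
        using eq by (rule root_invariant[where Q = "\<lambda>i. x (Some i)"])
      then show ?thesis using x(2) True by auto
    qed (use x in \<open>auto simp: mem_cone_space\<close>)
    then have "x k = 0" for k using x by (cases k) auto
    then show "x = 0" by auto
  qed (use fin in auto)
  also have "\<dots> = Suc (card (root S ` vertices \<Gamma>))"
    using fin by (subst card_insert_disjoint) (auto simp: card_image)
  finally show ?thesis
    by (simp only: flat_dim_subspace[OF sub])
qed

text \<open>For gains in the integers, \<open>\<rho>\<close> is the floor function: rounding turns a solution with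
  \<open>z = 1\<close> into an integral potential.\<close>

lemma cone_char_poly:
  fixes \<Gamma> :: "('v, 'g::ab_group_add) gain_graph" and \<iota> :: "'g \<Rightarrow> 'k::field"
  assumes "simple_gain_graph \<Gamma>"
    and add: "\<And>g h. \<iota> (g + h) = \<iota> g + \<iota> h"
    and \<rho>: "\<And>y g. \<rho> (y + \<iota> g) = \<rho> y + g"
  shows "arrangement_char_poly (cone_space \<Gamma>) (cone_arrangement \<iota> \<Gamma>)
    = [:- 1, 1:] * balanced_poly \<Gamma>"
proof -
  let ?V = "cone_space \<Gamma> :: ('v option \<Rightarrow> 'k) set" and ?E = "edges \<Gamma>"
  define H where "H = (\<lambda>k. case k of
      Inl (u :: unit) \<Rightarrow> {x \<in> ?V. x None = 0}
    | Inr e \<Rightarrow> {x \<in> ?V. \<forall>(i, j, g)\<in>e. x (Some i) - x (Some j) = \<iota> g * x None})"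
  let ?F = "\<lambda>S. ?V \<inter> \<Inter> (H ` S)"
  have fin: "finite ?E"
    using assms(1) by (simp add: simple_gain_graph_def)
  have "\<iota> 0 = 0" using add[of 0 0] by (metis add.right_neutral add_left_cancel)
  then have neg: "\<iota> (- g) = - \<iota> g" for g
    using add[of g "- g"] by (simp add: eq_neg_iff_add_eq_0 add.commute)
  \<comment> \<open>As \<open>\<iota>\<close> is odd, the two triples of an edge class impose the
    same equation.\<close>
  have H_edge: "H (Inr (edge i j g)) = {x \<in> ?V. x (Some i) - x (Some j) = \<iota> g * x None}"
    for i j g by (auto simp: H_def edge_def neg algebra_simps)
  have arr: "cone_arrangement \<iota> \<Gamma> = H ` ({()} <+> ?E)"
  proof -
    have "H ` Inr ` ?E = {{x \<in> ?V. x (Some i) - x (Some j) = \<iota> g * x None} | i j g. edge i j g \<in> ?E}"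
      (is "?L = ?R")
    proof
      show "?R \<subseteq> ?L" unfolding H_edge[symmetric] by blast
      show "?L \<subseteq> ?R"
      proof
        fix h assume "h \<in> ?L"
        then obtain e where e: "e \<in> ?E" "h = H (Inr e)" by auto
        then obtain i j g where "e = edge i j g"
          using assms(1) unfolding simple_gain_graph_def by blast
        then show "h \<in> ?R" unfolding e(2) using e(1) H_edge by blast
      qed
    qed
    moreover have "H ` Inl ` {()} = {{x \<in> ?V. x None = 0}}"
      by (simp add: H_def)
    ultimately show ?thesis
      by (simp add: cone_arrangement_def Plus_def image_Un)
  qed
  have proper: "\<not> ?V \<subseteq> H k" if "k \<in> {()} <+> ?E" for k
  proof (cases k)
    case (Inl u)
    have "(\<lambda>k. if k = None then 1 else 0) \<in> ?V - H k"
      by (auto simp: Inl H_def mem_cone_space)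
    then show ?thesis by blast
  next
    case (Inr e)
    then have "e \<in> ?E" using that by auto
    then obtain i j g where e: "i \<in> vertices \<Gamma>" "i \<noteq> j" "e = edge i j g"
      using assms(1) unfolding simple_gain_graph_def by blast
    have "(\<lambda>k. if k = Some i then 1 else 0) \<in> ?V - H k"
      using e by (auto simp: Inr H_edge mem_cone_space)
    then show ?thesis by blast
  qed
  have F0: "?F ({} <+> S) = {x \<in> ?V. \<forall>(i, j, g)\<in>\<Union>S. x (Some i) - x (Some j) = \<iota> g * x None}"
    for S by (auto simp: H_def Plus_def)
  have F1: "?F ({()} <+> S) = {x \<in> ?V. x None = 0 \<and> (\<forall>(i, j, g)\<in>\<Union>S. x (Some i) = x (Some j))}"
    for S by (fastforce simp: H_def Plus_def)
  have unbalanced: "?F ({} <+> S) = ?F ({()} <+> S)" if "\<not> balanced S" for S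
  proof -
    have "x None = 0"
      if x: "\<forall>(i, j, g)\<in>\<Union>S. x (Some i) - x (Some j) = \<iota> g * x None" for x :: "'v option \<Rightarrow> 'k"
    proof (rule ccontr)
      assume nz: "x None \<noteq> 0"
      \<comment> \<open>Division by \<open>x None\<close> scales the solution to
        \<open>z = 1\<close>, where \<open>\<rho>\<close> can be applied.\<close>
      have "g = \<rho> (x (Some i) / x None) - \<rho> (x (Some j) / x None)" if "(i, j, g) \<in> \<Union>S" for i j g
      proof -
        have "x (Some i) = x (Some j) + \<iota> g * x None"
          using x that by (fastforce simp: algebra_simps)
        then have "x (Some i) / x None = x (Some j) / x None + \<iota> g"
          using nz by (simp add: field_simps)
        then show ?thesis by (simp add: \<rho>)
      qed
      then have "balanced S" by (rule balancedI)
      then show False using \<open>\<not> balanced S\<close> by contradiction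
    qed
    then show ?thesis unfolding F0 F1 by fastforce
  qed
  let ?w = "\<lambda>S. (- 1) ^ card S * [:0, 1:] ^ flat_dim (?F S) :: int poly"
  have zero: "0 \<in> ?V" "k \<in> {()} <+> ?E \<Longrightarrow> 0 \<in> H k" for k
    by (auto simp: H_def mem_cone_space)
  have Pow1: "Pow {()} = {{}, {()}}" by auto
  have "arrangement_char_poly ?V (cone_arrangement \<iota> \<Gamma>) = (\<Sum>S\<in>Pow ({()} <+> ?E). ?w S)"
    unfolding arr using fin proper zero
    by (intro arrangement_char_poly_eq_sum_subfamilies[where a = 0]) auto
  also have "\<dots> = (\<Sum>S\<in>Pow ?E. ?w ({} <+> S) + ?w ({()} <+> S))"
    using fin by (subst sum_Pow_Plus) (simp_all add: Pow1)
  also have "\<dots> = (\<Sum>S\<in>Pow ?E. if balanced S then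
      [:- 1, 1:] * ((- 1) ^ card S * [:0, 1:] ^ card (root S ` vertices \<Gamma>)) else 0)"
  proof (intro sum.cong refl)
    fix S assume "S \<in> Pow ?E"
    then have S: "S \<subseteq> ?E" "finite S" using fin finite_subset by auto
    have card: "card ({} <+> S) = card S" "card ({()} <+> S) = Suc (card S)"
      using S(2) card_Plus[of "{}" S] card_Plus[of "{()}" S] by simp_all
    show "?w ({} <+> S) + ?w ({()} <+> S) = (if balanced S then
        [:- 1, 1:] * ((- 1) ^ card S * [:0, 1:] ^ card (root S ` vertices \<Gamma>)) else 0)"
    proof (cases "balanced S")
      case True
      \<comment> \<open>The two dimensions differ by one and the signs are opposite: with
        \<open>c\<close> components the pair contributes \<open>t ^ Suc c - t ^ c\<close>, up to the
        sign of \<open>S\<close>.\<close>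
      have "flat_dim (?F ({} <+> S)) = Suc (card (root S ` vertices \<Gamma>))"
        unfolding F0 by (rule cone_balanced_dim[OF assms(1) S(1) True add])
      moreover have "flat_dim (?F ({()} <+> S)) = card (root S ` vertices \<Gamma>)"
        unfolding F1 by (rule cone_restriction_dim[OF assms(1) S(1)])
      moreover have "[:- 1, 1:] = [:0, 1:] - (1 :: int poly)"
        by (simp add: one_pCons)
      ultimately show ?thesis
        using True by (simp only: card power_Suc if_True) (simp add: algebra_simps)
    next
      case False
      then show ?thesis by (simp only: card unbalanced[OF False]) simp
    qed
  qed
  also have "\<dots> = [:- 1, 1:] * balanced_poly \<Gamma>"
    unfolding balanced_poly_def sum_distrib_left
    using fin by (intro sum.inter_filter[symmetric]) simp
  finally show ?thesis .
qed

section \<open>The characteristic polynomial of \<B>(\<Gamma>)\<close>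

text \<open>On each component the solutions form a line, spanned by the exponential of the
  potential. A zero coordinate at a vertex of \<open>J\<close> kills the whole component, so the
  components that miss \<open>J\<close> remain.\<close>

lemma b_balanced_dim:
  fixes \<Gamma> :: "('v, 'g::ab_group_add) gain_graph" and \<phi> :: "'g \<Rightarrow> complex"
  assumes "simple_gain_graph \<Gamma>" and "S \<subseteq> edges \<Gamma>" and "balanced S"
    and mult: "\<And>g h. \<phi> (g + h) = \<phi> g * \<phi> h" and nz: "\<And>g. \<phi> g \<noteq> 0"
    and J: "J \<subseteq> vertices \<Gamma>"
  shows "flat_dim {x \<in> coord_space (vertices \<Gamma>).
      (\<forall>i\<in>J. x i = 0) \<and> (\<forall>(i, j, g)\<in>\<Union>S. x i = \<phi> g * x j)}
    = card (root S ` vertices \<Gamma> - root S ` J)" (is "flat_dim ?W = card ?P")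
proof -
  note S = assms(1,2)
  obtain \<theta> where \<theta>: "\<And>i j g. (i, j, g) \<in> \<Union>S \<Longrightarrow> g = \<theta> i - \<theta> j"
    using assms(3) unfolding balanced_def by fast
  have one: "\<phi> 0 = 1"
    using mult[of 0 0] nz[of 0] by simp
  \<comment> \<open>Subtracting \<open>\<theta> r\<close> normalises the solution to the value
    \<open>1\<close> at the root.\<close>
  define b where "b r i = (if i \<in> vertices \<Gamma> \<and> root S i = r then \<phi> (\<theta> i - \<theta> r) else 0)" for r i
  have sub: "coord.subspace ?W"
    by (rule coord.subspaceI) (fastforce simp: coord_space_def algebra_simps)+
  have "coord.dim ?W = card ?P"
  proof (rule dim_eq_card_dual_points[OF sub, where b = b])
    show "finite ?P"
      using assms(1) by (simp add: simple_gain_graph_def)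
  next
    fix r assume r: "r \<in> ?P"
    have "b r i = \<phi> g * b r j" if "(i, j, g) \<in> \<Union>S" for i j g
    proof -
      have "i \<in> vertices \<Gamma> \<longleftrightarrow> j \<in> vertices \<Gamma>"
        using root_eq_edge[OF S that] root_in_vertices[OF S] by metis
      moreover have "\<phi> (\<theta> i - \<theta> r) = \<phi> g * \<phi> (\<theta> j - \<theta> r)"
        using \<theta>[OF that] by (simp flip: mult)
      ultimately show ?thesis
        using root_eq_edge[OF S that] by (simp add: b_def)
    qed
    moreover have "b r i = 0" if "i \<in> J" for i
      using r that by (auto simp: b_def) (metis image_eqI)
    moreover have "b r \<in> coord_space (vertices \<Gamma>)"
      by (simp add: coord_space_def b_def)
    ultimately show "b r \<in> ?W" by blast
  next
    fix r s assume "r \<in> ?P" "s \<in> ?P"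
    then show "b r s = (if r = s then 1 else 0)"
      by (auto simp: b_def one root_root[OF S] root_in_vertices[OF S])
  next
    fix x assume x: "x \<in> ?W" "\<And>r. r \<in> ?P \<Longrightarrow> x r = 0"
    \<comment> \<open>As \<open>\<phi>\<close> has no zeros, vanishing spreads along edges through a
      whole component.\<close>
    have "x i = 0 \<longleftrightarrow> x j = 0" if "(i, j, g) \<in> \<Union>S" for i j g
      using x(1) that nz[of g] by fastforce
    then have inv: "(x (root S i) = 0) = (x i = 0)" for i
      by (rule root_invariant[where Q = "\<lambda>i. x i = 0"])
    have "x i = 0" for i
    proof (cases "i \<in> vertices \<Gamma>")
      case True
      show ?thesis
      proof (cases "root S i \<in> root S ` J")
        case True
        then obtain j where "j \<in> J" "root S i = root S j" by auto
        then show ?thesis using x(1) inv[of i] inv[of j] by auto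
      next
        case False
        then show ?thesis using x(2)[of "root S i"] \<open>i \<in> vertices \<Gamma>\<close> inv[of i] by auto
      qed
    qed (use x in \<open>auto simp: coord_space_def\<close>)
    then show "x = 0" by auto
  qed
  then show ?thesis
    by (simp only: flat_dim_subspace[OF sub])
qed

lemma add_one_power_card:
  fixes u :: "'b::comm_ring_1"
  assumes "finite A"
  shows "(1 + u) ^ card A = (\<Sum>B\<in>Pow A. u ^ card B)"
  using assms
proof (induction A rule: finite_induct)
  case (insert a A)
  have "inj_on (insert a) (Pow A)" "Pow A \<inter> insert a ` Pow A = {}"
    using insert.hyps by (auto simp: inj_on_def)
  moreover have "card (insert a B) = Suc (card B)" if "B \<subseteq> A" for B
    using that insert.hyps finite_subset by (subst card_insert_disjoint) auto
  ultimately have "(\<Sum>B\<in>Pow (insert a A). u ^ card B) = (\<Sum>B\<in>Pow A. u ^ card B) + (\<Sum>B\<in>Pow A. u * u ^ card B)"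
    using insert.hyps by (simp add: Pow_insert sum.union_disjoint sum.reindex)
  then show ?case
    using insert by (simp add: algebra_simps sum_distrib_left sum.distrib)
qed simp

text \<open>Expanding \<open>(1 + u) ^ n\<close> with \<open>u = t - 1\<close> over subsets \<open>B\<close> of the unhit fibres leaves, for
  each \<open>B\<close>, an alternating sum over the subsets of the complement of \<open>f -` B\<close>.\<close>

lemma sum_alternating_unhit:
  fixes t :: "'b::comm_ring_1"
  assumes "finite V"
  shows "(\<Sum>J\<in>Pow V. (- 1) ^ card J * t ^ card (f ` V - f ` J)) = (t - 1) ^ card (f ` V)"
proof -
  have "(\<Sum>J\<in>Pow V. (- 1) ^ card J * t ^ card (f ` V - f ` J))
    = (\<Sum>J\<in>Pow V. \<Sum>B\<in>Pow (f ` V - f ` J). (- 1) ^ card J * (t - 1) ^ card B)"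
    using assms by (simp add: add_one_power_card[of _ "t - 1", simplified] sum_distrib_left)
  also have "\<dots> = (\<Sum>J\<in>Pow V. \<Sum>B\<in>{B \<in> Pow (f ` V). B \<inter> f ` J = {}}. (- 1) ^ card J * (t - 1) ^ card B)"
    by (intro sum.cong) auto
  also have "\<dots> = (\<Sum>B\<in>Pow (f ` V). \<Sum>J\<in>{J \<in> Pow V. B \<inter> f ` J = {}}. (- 1) ^ card J * (t - 1) ^ card B)"
    using assms by (intro sum.swap_restrict) auto
  also have "\<dots> = (\<Sum>B\<in>Pow (f ` V). if B = f ` V then (t - 1) ^ card B else 0)"
  proof (intro sum.cong refl)
    fix B assume B: "B \<in> Pow (f ` V)"
    have "{J \<in> Pow V. B \<inter> f ` J = {}} = Pow (V - f -` B)" by auto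
    \<comment> \<open>The alternating sum is \<open>1\<close> over an empty complement and
      \<open>0\<close> otherwise, so only the full image survives.\<close>
    moreover have "V - f -` B = {} \<longleftrightarrow> B = f ` V" using B by auto
    ultimately show "(\<Sum>J\<in>{J \<in> Pow V. B \<inter> f ` J = {}}. (- 1) ^ card J * (t - 1) ^ card B)
      = (if B = f ` V then (t - 1) ^ card B else 0)"
      using assms by (simp add: sum_Pow_alternating flip: sum_distrib_right)
  qed
  also have "\<dots> = (t - 1) ^ card (f ` V)"
    using assms by simp
  finally show ?thesis .
qed

text \<open>The logarithm is taken relative to a chosen representative of each orbit of the group
  \<open>range \<phi>\<close> acting on the nonzero scalars.\<close>

lemma exists_logarithm:
  fixes \<phi> :: "'g::ab_group_add \<Rightarrow> complex"
  assumes mult: "\<And>g h. \<phi> (g + h) = \<phi> g * \<phi> h" and nz: "\<And>g. \<phi> g \<noteq> 0" and inj: "inj \<phi>"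
  shows "\<exists>\<tau>. \<forall>g y. y \<noteq> 0 \<longrightarrow> \<tau> (\<phi> g * y) = \<tau> y + g"
proof -
  define orbit where "orbit y = range (\<lambda>h. \<phi> h * y)" for y
  \<comment> \<open>The choice sees only the set \<open>orbit y\<close>, so all points of one orbit
    share their representative.\<close>
  define rep where "rep y = (SOME r. r \<in> orbit y)" for y
  define \<tau> where "\<tau> y = (SOME h. y = \<phi> h * rep y)" for y
  have one: "\<phi> 0 = 1"
    using mult[of 0 0] nz[of 0] by simp
  have rep_ex: "\<exists>h. y = \<phi> h * rep y" for y
  proof -
    have "\<phi> 0 * y \<in> orbit y" unfolding orbit_def by blast
    then have "rep y \<in> orbit y" unfolding rep_def by (rule someI)
    then obtain h where "rep y = \<phi> h * y" by (auto simp: orbit_def)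
    then have "\<phi> (- h) * rep y = y"
      using mult[of "- h" h] by (simp add: one flip: mult.assoc)
    then show ?thesis by metis
  qed
  have \<tau>: "y = \<phi> (\<tau> y) * rep y" for y
    unfolding \<tau>_def by (rule someI_ex[OF rep_ex])
  show ?thesis
  proof (intro exI allI impI)
    fix g :: 'g and y :: complex assume "y \<noteq> 0"
    have "orbit (\<phi> g * y) = orbit y"
    proof -
      have "\<phi> h * (\<phi> g * y) = \<phi> (h + g) * y" "\<phi> h * y = \<phi> (h - g) * (\<phi> g * y)" for h
        using mult[of "h - g" g] by (simp_all add: mult)
      then show ?thesis unfolding orbit_def by blast
    qed
    then have "rep (\<phi> g * y) = rep y" by (simp add: rep_def)
    then have "\<phi> g * y = \<phi> (\<tau> (\<phi> g * y)) * rep y" using \<tau> by metis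
    moreover have "\<phi> g * y = \<phi> (\<tau> y + g) * rep y"
      using \<tau>[of y] by (simp add: mult mult.assoc mult.left_commute)
    moreover have "rep y \<noteq> 0" using \<tau>[of y] \<open>y \<noteq> 0\<close> by auto
    ultimately show "\<tau> (\<phi> g * y) = \<tau> y + g"
      using inj by (auto dest: injD)
  qed
qed

text \<open>A nowhere vanishing solution is glued from one solution per component; its logarithm is a
  potential.\<close>

lemma unbalanced_vanishing:
  fixes \<Gamma> :: "('v, 'g::ab_group_add) gain_graph" and \<phi> :: "'g \<Rightarrow> complex"
  assumes "simple_gain_graph \<Gamma>" and "S \<subseteq> edges \<Gamma>" and "\<not> balanced S"
    and mult: "\<And>g h. \<phi> (g + h) = \<phi> g * \<phi> h" and nz: "\<And>g. \<phi> g \<noteq> 0" and inj: "inj \<phi>"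
  obtains v where "v \<in> vertices \<Gamma>"
    "\<And>x. \<forall>(i, j, g)\<in>\<Union>S. x i = \<phi> g * x j \<Longrightarrow> x v = 0"
proof (rule ccontr)
  note S = assms(1,2)
  assume "\<not> thesis"
  \<comment> \<open>If no vertex is forced to zero, each vertex has its own solution that does not
    vanish there.\<close>
  then have "\<forall>v\<in>vertices \<Gamma>. \<exists>x. (\<forall>(i, j, g)\<in>\<Union>S. x i = \<phi> g * x j) \<and> x v \<noteq> 0"
    using that by blast
  then obtain X where X: "\<And>v. v \<in> vertices \<Gamma> \<Longrightarrow> \<forall>(i, j, g)\<in>\<Union>S. X v i = \<phi> g * X v j"
    "\<And>v. v \<in> vertices \<Gamma> \<Longrightarrow> X v v \<noteq> 0"
    by metis
  obtain \<tau> where \<tau>: "\<And>g y. y \<noteq> 0 \<Longrightarrow> \<tau> (\<phi> g * y) = \<tau> y + g"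
    using exists_logarithm[of \<phi>, OF mult nz inj] by blast
  \<comment> \<open>Each value comes from the solution chosen for the root of the component, so both
    ends of an edge use the same solution.\<close>
  define y where "y i = X (root S i) i" for i
  have y_nz: "y i \<noteq> 0" if "i \<in> vertices \<Gamma>" for i
  proof -
    have r: "root S i \<in> vertices \<Gamma>" using that root_in_vertices[OF S] by blast
    have "X (root S i) k = 0 \<longleftrightarrow> X (root S i) l = 0" if "(k, l, g) \<in> \<Union>S" for k l g
      using X(1)[OF r] that nz[of g] by fastforce
    then have "(X (root S i) (root S i) = 0) = (X (root S i) i = 0)"
      by (rule root_invariant[where Q = "\<lambda>k. X (root S i) k = 0"])
    then show ?thesis using X(2)[OF r] by (simp add: y_def)
  qed
  have "g = \<tau> (y i) - \<tau> (y j)" if e: "(i, j, g) \<in> \<Union>S" for i j g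
  proof -
    have j: "j \<in> vertices \<Gamma>" using simple_edge_vertices[OF S(1) subsetD[OF Union_mono[OF S(2)] e]] by simp
    then have "root S j \<in> vertices \<Gamma>" using root_in_vertices[OF S] by blast
    then have "y i = \<phi> g * y j"
      using X(1)[of "root S j"] e root_eq_edge[OF S e] by (fastforce simp: y_def)
    then show ?thesis using \<tau>[OF y_nz[OF j], of g] by simp
  qed
  then have "balanced S" by (rule balancedI)
  with assms(3) show False ..
qed

text \<open>For each edge set \<open>S\<close> the sum over the sets \<open>J\<close> of coordinate
  hyperplanes is taken first. It turns \<open>t\<close> into \<open>t - 1\<close> if
  \<open>S\<close> is balanced; otherwise some coordinate is forced to zero and the sum
  cancels.\<close>

lemma b_char_poly:
  fixes \<Gamma> :: "('v, 'g::ab_group_add) gain_graph" and \<phi> :: "'g \<Rightarrow> complex"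
  assumes "simple_gain_graph \<Gamma>"
    and mult: "\<And>g h. \<phi> (g + h) = \<phi> g * \<phi> h" and nz: "\<And>g. \<phi> g \<noteq> 0" and inj: "inj \<phi>"
  shows "arrangement_char_poly (coord_space (vertices \<Gamma>)) (b_arrangement \<phi> \<Gamma>)
    = balanced_poly \<Gamma> \<circ>\<^sub>p [:- 1, 1:]"
proof -
  let ?E = "edges \<Gamma>" and ?U = "vertices \<Gamma>"
  let ?V = "coord_space ?U :: ('v \<Rightarrow> complex) set"
  define H where "H = (\<lambda>k. case k of
      Inl i \<Rightarrow> {x \<in> ?V. x i = 0}
    | Inr e \<Rightarrow> {x \<in> ?V. \<forall>(i, j, g)\<in>e. x i = \<phi> g * x j})"
  let ?F = "\<lambda>S. ?V \<inter> \<Inter> (H ` S)"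
  have fin: "finite ?E" "finite ?U"
    using assms(1) by (simp_all add: simple_gain_graph_def)
  have one: "\<phi> 0 = 1"
    using mult[of 0 0] nz[of 0] by simp
  \<comment> \<open>Since \<open>\<phi> (- g)\<close> is the inverse of \<open>\<phi> g\<close>, an
    edge gives the same hyperplane in both directions.\<close>
  have flip: "x j = \<phi> (- g) * x i \<longleftrightarrow> x i = \<phi> g * x j" for x :: "'v \<Rightarrow> complex" and i j g
    using mult[of g "- g"] by (auto simp: one simp flip: mult.assoc) (metis mult.commute)
  have H_edge: "H (Inr (edge i j g)) = {x \<in> ?V. x i - \<phi> g * x j = 0}" for i j g
    using flip[of _ j g i] by (auto simp: H_def edge_def)
  have arr: "b_arrangement \<phi> \<Gamma> = H ` (?U <+> ?E)"
  proof -
    have "H ` Inr ` ?E = {{x \<in> ?V. x i - \<phi> g * x j = 0} | i j g. edge i j g \<in> ?E}"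
      (is "?L = ?R")
    proof
      show "?R \<subseteq> ?L" unfolding H_edge[symmetric] by blast
      show "?L \<subseteq> ?R"
      proof
        fix h assume "h \<in> ?L"
        then obtain e where e: "e \<in> ?E" "h = H (Inr e)" by auto
        then obtain i j g where "e = edge i j g"
          using assms(1) unfolding simple_gain_graph_def by blast
        then show "h \<in> ?R" unfolding e(2) using e(1) H_edge by blast
      qed
    qed
    moreover have "H ` Inl ` ?U = {{x \<in> ?V. x i = 0} | i. i \<in> ?U}"
      unfolding H_def by (simp only: image_image sum.case) blast
    ultimately show ?thesis
      by (simp add: b_arrangement_def Plus_def image_Un)
  qed
  have proper: "\<not> ?V \<subseteq> H k" if "k \<in> ?U <+> ?E" for k
  proof (cases k)
    case (Inl i)
    have "(\<lambda>k. if k = i then 1 else 0) \<in> ?V - H k"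
      using Inl that by (auto simp: H_def coord_space_def)
    then show ?thesis by blast
  next
    case (Inr e)
    then have "e \<in> ?E" using that by auto
    then obtain i j g where e: "i \<in> ?U" "i \<noteq> j" "e = edge i j g"
      using assms(1) unfolding simple_gain_graph_def by blast
    have "(\<lambda>k. if k = i then 1 else 0) \<in> ?V - H k"
      using e by (auto simp: Inr H_edge coord_space_def)
    then show ?thesis by blast
  qed
  have F: "?F (J <+> S) = {x \<in> ?V. (\<forall>i\<in>J. x i = 0) \<and> (\<forall>(i, j, g)\<in>\<Union>S. x i = \<phi> g * x j)}"
    for J S by (fastforce simp: H_def Plus_def ball_Un)
  let ?w = "\<lambda>S. (- 1) ^ card S * [:0, 1:] ^ flat_dim (?F S) :: int poly"
  have zero: "0 \<in> ?V" "k \<in> ?U <+> ?E \<Longrightarrow> 0 \<in> H k" for k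
    by (auto simp: H_def coord_space_def)
  have "arrangement_char_poly ?V (b_arrangement \<phi> \<Gamma>) = (\<Sum>S\<in>Pow (?U <+> ?E). ?w S)"
    unfolding arr using fin proper zero
    by (intro arrangement_char_poly_eq_sum_subfamilies[where a = 0]) auto
  also have "\<dots> = (\<Sum>S\<in>Pow ?E. \<Sum>J\<in>Pow ?U. ?w (J <+> S))"
    using fin by (subst sum_Pow_Plus) simp_all
  also have "\<dots> = (\<Sum>S\<in>Pow ?E. if balanced S then
      (- 1) ^ card S * [:- 1, 1:] ^ card (root S ` ?U) else 0)"
  proof (intro sum.cong refl)
    fix S assume "S \<in> Pow ?E"
    then have S: "S \<subseteq> ?E" "finite S" using fin finite_subset by auto
    have card: "card (J <+> S) = card J + card S" if "J \<subseteq> ?U" for J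
      using S(2) that fin finite_subset by (intro card_Plus) auto
    show "(\<Sum>J\<in>Pow ?U. ?w (J <+> S)) = (if balanced S then
        (- 1) ^ card S * [:- 1, 1:] ^ card (root S ` ?U) else 0)"
    proof (cases "balanced S")
      case True
      have "(\<Sum>J\<in>Pow ?U. ?w (J <+> S)) = (\<Sum>J\<in>Pow ?U.
          (- 1) ^ card S * ((- 1) ^ card J * [:0, 1:] ^ card (root S ` ?U - root S ` J)))"
      proof (intro sum.cong refl)
        fix J assume "J \<in> Pow ?U"
        then have J: "J \<subseteq> ?U" by simp
        show "?w (J <+> S) = (- 1) ^ card S * ((- 1) ^ card J * [:0, 1:] ^ card (root S ` ?U - root S ` J))"
          unfolding F b_balanced_dim[OF assms(1) S(1) True mult nz J] card[OF J]
          by (simp add: power_add mult_ac)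
      qed
      also have "\<dots> = (- 1) ^ card S * ([:0, 1:] - 1) ^ card (root S ` ?U)"
        by (simp only: sum_alternating_unhit[OF fin(2)] flip: sum_distrib_left)
      also have "[:0, 1:] - 1 = [:- 1, 1 :: int:]"
        by (simp add: one_pCons)
      finally show ?thesis using True by simp
    next
      case False
      obtain v where v: "v \<in> ?U" "\<And>x. \<forall>(i, j, g)\<in>\<Union>S. x i = \<phi> g * x j \<Longrightarrow> x v = 0"
        using unbalanced_vanishing[OF assms(1) S(1) False mult nz inj] by metis
      have "(\<Sum>J\<in>Pow ?U. ?w (J <+> S)) = 0"
      proof (rule sum_Pow_sign_reversing[OF fin(2) v(1)])
        fix J assume J: "J \<subseteq> ?U - {v}"
        \<comment> \<open>The coordinate at \<open>v\<close> vanishes already, so the extra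
          hyperplane changes only the sign.\<close>
        have "?F (insert v J <+> S) = ?F (J <+> S)"
          unfolding F using v(2) by blast
        moreover have "card (insert v J <+> S) = Suc (card (J <+> S))"
        proof -
          have "J \<subseteq> ?U" "v \<notin> J" using J by auto
          moreover from this have "finite J" using fin finite_subset by blast
          ultimately show ?thesis using v(1) by (simp add: card)
        qed
        ultimately show "?w (insert v J <+> S) = - ?w (J <+> S)"
          by simp
      qed
      then show ?thesis using False by simp
    qed
  qed
  also have "\<dots> = balanced_poly \<Gamma> \<circ>\<^sub>p [:- 1, 1:]"
  proof -
    have "((- 1) ^ n * [:0, 1:] ^ m) \<circ>\<^sub>p [:- 1, 1:] = (- 1) ^ n * [:- 1, 1 :: int:] ^ m" for n m
      by (cases "even n") (simp_all add: pcompose_mult pcompose_hom.hom_power pcompose_uminus pcompose_pCons)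
    then show ?thesis
      unfolding balanced_poly_def pcompose_sum
      using fin by (subst sum.inter_filter[symmetric]) simp_all
  qed
  finally show ?thesis .
qed


subsection \<open>Divisional freeness\<close>

text \<open>The formulas for the characteristic polynomials are stated for simple gain graphs, so
  repeated contraction has to stay in this class. The condition \<open>k \<noteq> j\<close> excludes
  loops.\<close>

lemma simple_gain_graph_contract:
  assumes "simple_gain_graph \<Gamma>" and "edge i j g \<in> edges \<Gamma>"
  shows "simple_gain_graph (contract \<Gamma> i j g)"
proof -
  have mem: "(u, v, h) \<in> \<Union>(edges \<Gamma>)" if "edge u v h \<in> edges \<Gamma>" for u v h
    using that by (auto simp: edge_def)
  note vert = simple_edge_vertices[OF assms(1) mem]
  have fin: "finite (\<Union>(edges \<Gamma>))"
    using assms(1) by (auto simp: simple_gain_graph_def edge_def)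
  let ?A = "{edge u v h | u v h. edge u v h \<in> edges \<Gamma> \<and> u \<noteq> i \<and> v \<noteq> i}"
  let ?B = "{edge k j (h + g) | k h. edge k i h \<in> edges \<Gamma> \<and> k \<noteq> i \<and> k \<noteq> j}"
  have "finite ?A"
    using assms(1) by (auto simp: simple_gain_graph_def intro: finite_subset[of _ "edges \<Gamma>"])
  \<comment> \<open>The finitely many triples in the edges index all redirected edges.\<close>
  moreover have "?B \<subseteq> (\<lambda>(k, _, h). edge k j (h + g)) ` \<Union>(edges \<Gamma>)"
    using mem by force
  then have "finite ?B"
    using fin by (meson finite_imageI finite_subset)
  moreover have "\<exists>u\<in>vertices \<Gamma> - {i}. \<exists>v\<in>vertices \<Gamma> - {i}. \<exists>h. u \<noteq> v \<and> e = edge u v h"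
    if "e \<in> ?A \<union> ?B" for e
    using that
  proof
    assume "e \<in> ?A"
    then obtain u v h where "e = edge u v h" "edge u v h \<in> edges \<Gamma>" "u \<noteq> i" "v \<noteq> i" by blast
    then show ?thesis using vert[of u v h] by blast
  next
    assume "e \<in> ?B"
    then obtain k h where "e = edge k j (h + g)" "edge k i h \<in> edges \<Gamma>" "k \<noteq> i" "k \<noteq> j" by blast
    then show ?thesis using vert[of k i h] vert[OF assms(2)] by blast
  qed
  ultimately show ?thesis
    using assms(1) by (simp add: simple_gain_graph_def contract_def)
qed

text \<open>The same sequence of contracted edges serves for \<open>\<chi>'\<close>, because every
  graph along it is simple.\<close>

lemma div_free_along_edges_mono:
  assumes "div_free_along_edges \<chi> \<Gamma>" and "simple_gain_graph \<Gamma>"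
    and "\<And>\<Gamma> \<Delta>. simple_gain_graph \<Gamma> \<Longrightarrow> simple_gain_graph \<Delta> \<Longrightarrow> \<chi> \<Delta> dvd \<chi> \<Gamma> \<Longrightarrow> \<chi>' \<Delta> dvd \<chi>' \<Gamma>"
  shows "div_free_along_edges \<chi>' \<Gamma>"
  using assms(1,2)
proof (induction rule: div_free_along_edges.induct)
  case (contract i j g \<Gamma>)
  then show ?case
    using assms(3) simple_gain_graph_contract by (metis div_free_along_edges.contract)
qed (rule div_free_along_edges.empty)

text \<open>Substituting \<open>t - 1\<close> for \<open>t\<close> is a ring automorphism, with
  inverse the substitution of \<open>t + 1\<close>.\<close>

lemma pcompose_shift_dvd_iff:
  fixes p r :: "int poly"
  shows "p \<circ>\<^sub>p [:- 1, 1:] dvd r \<circ>\<^sub>p [:- 1, 1:] \<longleftrightarrow> p dvd r"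
proof
  have inverse: "s \<circ>\<^sub>p [:- 1, 1:] \<circ>\<^sub>p [:1, 1:] = s" for s :: "int poly"
    by (simp add: pcompose_pCons flip: pcompose_assoc)
  have comp: "a \<circ>\<^sub>p c dvd b \<circ>\<^sub>p c" if "a dvd b" for a b c :: "int poly"
    using that by (auto simp: pcompose_mult)
  show "p \<circ>\<^sub>p [:- 1, 1:] dvd r \<circ>\<^sub>p [:- 1, 1:]" if "p dvd r"
    using that by (rule comp)
  show "p dvd r" if "p \<circ>\<^sub>p [:- 1, 1:] dvd r \<circ>\<^sub>p [:- 1, 1:]"
    using comp[OF that, of "[:1, 1:]"] by (simp only: inverse)
qed

text \<open>The hypotheses on \<open>\<iota>\<close>, \<open>\<rho>\<close> and
  \<open>\<phi>\<close> isolate what the integers and the prime fields have in common. Both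
  divisibility conditions reduce to divisibility of \<open>balanced_poly\<close>.\<close>

lemma cone_div_free_iff_b_div_free:
  fixes \<Gamma> :: "('v, 'g::ab_group_add) gain_graph" and \<iota> :: "'g \<Rightarrow> 'k::field"
  assumes "simple_gain_graph \<Gamma>"
    and "\<And>g h. \<iota> (g + h) = \<iota> g + \<iota> h" and "\<And>y g. \<rho> (y + \<iota> g) = \<rho> y + g"
    and "\<And>g h. \<phi> (g + h) = \<phi> g * \<phi> h" and "\<And>g. \<phi> g \<noteq> 0" and "inj \<phi>"
  shows "cone_div_free \<iota> \<Gamma> \<longleftrightarrow> b_div_free \<phi> \<Gamma>"
proof -
  note cone = cone_char_poly[OF _ assms(2,3)] and b = b_char_poly[OF _ assms(4-6)]
  \<comment> \<open>The factor \<open>t - 1\<close> of the cone cancels from both sides of the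
    divisibility.\<close>
  have "[:- 1, 1:] \<noteq> (0 :: int poly)" by simp
  then have "arrangement_char_poly (cone_space \<Delta>) (cone_arrangement \<iota> \<Delta>) dvd
      arrangement_char_poly (cone_space \<Gamma>) (cone_arrangement \<iota> \<Gamma>) \<longleftrightarrow>
    arrangement_char_poly (coord_space (vertices \<Delta>)) (b_arrangement \<phi> \<Delta>) dvd
      arrangement_char_poly (coord_space (vertices \<Gamma>)) (b_arrangement \<phi> \<Gamma>)"
    if "simple_gain_graph \<Gamma>" "simple_gain_graph \<Delta>" for \<Gamma> \<Delta> :: "('v, 'g) gain_graph"
    using that by (simp only: cone b pcompose_shift_dvd_iff dvd_mult_cancel_left simp_thms)
  then show ?thesis
    unfolding cone_div_free_def b_div_free_def
    by (intro iffI; elim div_free_along_edges_mono[OF _ assms(1)]) simp_all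
qed

section \<open>Exponentials on the two gain groups\<close>

lemma inj_powi_no_root_of_unity:
  fixes q :: complex
  assumes "q \<noteq> 0" and "\<And>n. n > 0 \<Longrightarrow> q ^ n \<noteq> 1"
  shows "inj (\<lambda>g. q powi g)"
proof -
  \<comment> \<open>The assumption is symmetric in \<open>a\<close> and \<open>b\<close>, so one
    inequality suffices. Its failure would make a positive power of \<open>q\<close> equal to
    \<open>1\<close>.\<close>
  have "a \<ge> b" if "q powi a = q powi b" for a b
  proof (rule ccontr)
    assume "\<not> a \<ge> b"
    moreover have "q powi (b - a) = 1"
      using that assms(1) by (simp add: power_int_diff)
    ultimately show False
      using assms(2)[of "nat (b - a)"] by (simp add: power_int_def)
  qed
  then show ?thesis by (intro injI antisym) metis+
qed

text \<open>Powers of \<open>q\<close> depend only on the exponent modulo \<open>p\<close>, so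
  reducing a sum of representatives is harmless. Distinct representatives differ by less than
  \<open>p\<close>, so primitivity gives injectivity.\<close>

lemma powi_mod_ring:
  fixes q :: complex
  assumes "primitive_root_of_unity CARD('p::prime_card) q"
  shows "q powi to_int_mod_ring (g + h :: 'p mod_ring)
      = q powi to_int_mod_ring g * q powi to_int_mod_ring h"
    and "inj (\<lambda>g :: 'p mod_ring. q powi to_int_mod_ring g)"
proof -
  let ?p = "CARD('p)"
  have q: "q ^ ?p = 1" "\<And>k. 0 < k \<Longrightarrow> k < ?p \<Longrightarrow> q ^ k \<noteq> 1"
    using assms by (auto simp: primitive_root_of_unity_def)
  have q0: "q \<noteq> 0" using q(1) by (auto simp: power_0_left)
  have "q powi (int ?p) = 1" using q(1) by simp
  then have period: "q powi (a mod int ?p) = q powi a" for a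
    using q0 power_int_add[of q "int ?p * (a div int ?p)" "a mod int ?p"]
    by (simp add: power_int_mult)
  have "to_int_mod_ring (g + h) = (to_int_mod_ring g + to_int_mod_ring h) mod int ?p"
    by transfer simp
  then show "q powi to_int_mod_ring (g + h) = q powi to_int_mod_ring g * q powi to_int_mod_ring h"
    using q0 by (simp add: period power_int_add)
  have range: "0 \<le> to_int_mod_ring a" "to_int_mod_ring a < int ?p" for a :: "'p mod_ring"
    using range_to_int_mod_ring[where 'a = 'p] by (metis atLeastLessThan_iff rangeI)+
  have le: "to_int_mod_ring a \<ge> to_int_mod_ring b"
    if "q powi to_int_mod_ring a = q powi to_int_mod_ring b" for a b :: "'p mod_ring"
  proof (rule ccontr)
    let ?d = "to_int_mod_ring b - to_int_mod_ring a"
    assume "\<not> to_int_mod_ring a \<ge> to_int_mod_ring b"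
    moreover have "q powi ?d = 1"
      using that q0 by (simp add: power_int_diff)
    ultimately show False
      using q(2)[of "nat ?d"] range[of a] range[of b] by (simp add: power_int_def nat_less_iff)
  qed
  show "inj (\<lambda>g :: 'p mod_ring. q powi to_int_mod_ring g)"
    by (rule injI) (metis le antisym to_int_mod_ring_hom.injectivity)
qed

theorem theorem1p16:
  fixes l :: nat
  shows
    "(\<forall>(\<Gamma> :: (nat, int) gain_graph) (q :: complex).
        simple_gain_graph \<Gamma> \<and> vertices \<Gamma> = {1..l} \<and>
        q \<noteq> 0 \<and> (\<forall>n>0. q ^ n \<noteq> 1) \<longrightarrow>
        (cone_div_free (of_int :: int \<Rightarrow> rat) \<Gamma> \<longleftrightarrow> b_div_free (\<lambda>g. q powi g) \<Gamma>)) \<and>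
     (\<forall>(\<Gamma> :: (nat, 'p::prime_card mod_ring) gain_graph) (q :: complex).
        simple_gain_graph \<Gamma> \<and> vertices \<Gamma> = {1..l} \<and>
        primitive_root_of_unity CARD('p) q \<longrightarrow>
        (cone_div_free (\<lambda>g. g) \<Gamma> \<longleftrightarrow> b_div_free (\<lambda>g. q powi to_int_mod_ring g) \<Gamma>))"
proof (intro conjI allI impI; elim conjE)
  fix \<Gamma> :: "(nat, int) gain_graph" and q :: complex
  assume "simple_gain_graph \<Gamma>" "q \<noteq> 0" "\<forall>n>0. q ^ n \<noteq> 1"
  then show "cone_div_free (of_int :: int \<Rightarrow> rat) \<Gamma> \<longleftrightarrow> b_div_free (\<lambda>g. q powi g) \<Gamma>"
    by (intro cone_div_free_iff_b_div_free[where \<rho> = floor] inj_powi_no_root_of_unity)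
      (auto simp: power_int_add)
next
  fix \<Gamma> :: "(nat, 'p mod_ring) gain_graph" and q :: complex
  assume \<Gamma>: "simple_gain_graph \<Gamma>" and q: "primitive_root_of_unity CARD('p) q"
  then have "q \<noteq> 0" by (auto simp: primitive_root_of_unity_def power_0_left)
  \<comment> \<open>The ground field is the gain group itself, so the identity serves as
    \<open>\<rho>\<close>.\<close>
  then show "cone_div_free (\<lambda>g. g) \<Gamma> \<longleftrightarrow> b_div_free (\<lambda>g. q powi to_int_mod_ring g) \<Gamma>"
    by (intro cone_div_free_iff_b_div_free[where \<rho> = "\<lambda>y. y"] \<Gamma> powi_mod_ring[OF q]) auto
qed

end
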